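(* Let $\mathbf{R}$ be the set of all rational functions which belong to the Dirichlet space $\mathfrak{D}(\mathbb{C}^+)$. Then $\mathbf{R}$ is dense in $\mathfrak{D}(\mathbb{C}^+)$.
   Context: $\mathbb{C}^+=\{z\in\mathbb{C}:\operatorname{Im} z>0\}$ is the upper half-plane and $dA$ is Lebesgue area measure. The Dirichlet space $\mathfrak{D}(\mathbb{C}^+)$ consists of all analytic functions $f$ on $\mathbb{C}^+$ with $\int_{\mathbb{C}^+}|f'(z)|^2\,dA(z)<\infty$, and it carries the norm given by $\|f\|^2_{\mathfrak{D}(\mathbb{C}^+)}=|f(i)|^2+\int_{\mathbb{C}^+}|f'(z)|^2\,dA(z)$, under which it is a Hilbert space. Density is with respect to this norm. *)

theory Defs
  imports "HOL-Complex_Analysis.Complex_Analysis"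
    "HOL-Computational_Algebra.Polynomial"
begin

text \<open>
  Functions on the upper half-plane are represented by functions of type
  \<^typ>\<open>complex \<Rightarrow> complex\<close> whose values off the half-plane are irrelevant: every
  notion below depends only on the restriction to \<open>upper_half_plane\<close> (for \<^const>\<open>deriv\<close>
  because the half-plane is open).
\<close>

definition upper_half_plane :: "complex set" where
  "upper_half_plane = {z. Im z > 0}"

definition dirichlet_space :: "(complex \<Rightarrow> complex) set" where
  "dirichlet_space =
     {f. f holomorphic_on upper_half_plane \<and>
         set_integrable lborel upper_half_plane (\<lambda>z. (cmod (deriv f z))\<^sup>2)}"

text \<open>
  The Bochner integral is \<open>0\<close> on non-integrable functions, so this is the Dirichlet norm
  only for members of \<open>dirichlet_space\<close>.
\<close>

definition dirichlet_norm :: "(complex \<Rightarrow> complex) \<Rightarrow> real" where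
  "dirichlet_norm f =
     sqrt ((cmod (f \<i>))\<^sup>2 +
           set_lebesgue_integral lborel upper_half_plane (\<lambda>z. (cmod (deriv f z))\<^sup>2))"

text \<open>
  A rational function that is analytic on the half-plane has, in lowest terms, a denominator
  without zeros there.  Requiring this of the denominator rules out the convention
  \<open>x / 0 = 0\<close>.
\<close>

definition rational_on :: "complex set \<Rightarrow> (complex \<Rightarrow> complex) \<Rightarrow> bool" where
  "rational_on S f \<longleftrightarrow>
     (\<exists>p q :: complex poly. \<forall>z\<in>S. poly q z \<noteq> 0 \<and> f z = poly p z / poly q z)"

definition dirichlet_rational :: "(complex \<Rightarrow> complex) set" where
  "dirichlet_rational = {f \<in> dirichlet_space. rational_on upper_half_plane f}"

end

theory Submission
  imports Defs "HOL-Real_Asymp.Real_Asymp"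
begin

text \<open>
  The Dirichlet integral is conformally invariant: if \<open>\<phi>\<close> maps \<open>S\<close> bijectively and analytically
  onto \<open>\<phi> ` S\<close>, then the area integral of the squared modulus of \<open>deriv f\<close> over \<open>\<phi> ` S\<close> equals
  that of \<open>deriv (f \<circ> \<phi>)\<close> over \<open>S\<close>, because the squared modulus of \<open>deriv \<phi>\<close> is both the factor
  from the chain rule and the Jacobian determinant
  (\<open>dirichlet_integral_conformal_invariance\<close>).  Applied to the inverse Cayley transform
  \<open>w \<mapsto> \<i> * (1 + w) / (1 - w)\<close>, this moves the problem from the upper half-plane to the unit disc.

  On the disc, polynomials are dense among the square-integrable analytic functions
  (\<open>polynomials_dense_bergman_disc\<close>): such a function is the mean-square limit of its dilates,
  which are analytic on larger discs and so are uniform limits of Taylor polynomials there.  The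
  convergence of the dilates follows from pointwise convergence, since their norms are bounded by
  the norm of the limit (\<open>L2_convergence_of_norm_bound\<close>).

  Given \<open>f\<close> in the Dirichlet space of the half-plane, approximate the derivative of the transported
  function by a polynomial \<open>p\<close>, and let \<open>P\<close> be the antiderivative of \<open>p\<close> with \<open>P(0) = f(\<i>)\<close>.
  Transporting \<open>P\<close> back gives the function \<open>z \<mapsto> P((z - \<i>) / (z + \<i>))\<close>, which is rational, has
  finite Dirichlet integral because \<open>p\<close> is bounded on the disc, agrees with \<open>f\<close> at \<open>\<i>\<close>, and differs
  from \<open>f\<close> by as little in the Dirichlet integral as \<open>p\<close> does from the transported derivative.
\<close>

section \<open>Conformal invariance of the Dirichlet integral\<close>

text \<open>
  The general substitution rule for Lebesgue integrals is stated over \<open>real ^ 'n\<close>.  The next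
  definitions and lemmas identify the plane with \<open>real ^ 2\<close>, so that it applies to complex
  integrals.
\<close>

definition complex_of_vec :: "real^2 \<Rightarrow> complex" where
  "complex_of_vec v = Complex (v $ 1) (v $ 2)"

definition vec_of_complex :: "complex \<Rightarrow> real^2" where
  "vec_of_complex z = vector [Re z, Im z]"

lemma vec_of_complex_inverse [simp]: "complex_of_vec (vec_of_complex z) = z"
  by (simp add: complex_of_vec_def vec_of_complex_def complex_eq_iff)

lemma complex_of_vec_inverse [simp]: "vec_of_complex (complex_of_vec v) = v"
  by (simp add: complex_of_vec_def vec_of_complex_def vec_eq_iff forall_2)

lemma linear_complex_of_vec: "linear complex_of_vec"
  by (rule linearI) (simp_all add: complex_of_vec_def complex_eq_iff)

lemma linear_vec_of_complex: "linear vec_of_complex"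
  by (rule linearI) (simp_all add: vec_of_complex_def vec_eq_iff forall_2)

lemma bounded_linear_complex_of_vec: "bounded_linear complex_of_vec"
  using linear_complex_of_vec linear_conv_bounded_linear by blast

lemma bounded_linear_vec_of_complex: "bounded_linear vec_of_complex"
  using linear_vec_of_complex linear_conv_bounded_linear by blast

lemma measurable_complex_of_vec [measurable]: "complex_of_vec \<in> borel_measurable borel"
  using bounded_linear_complex_of_vec
  by (intro borel_measurable_continuous_onI linear_continuous_on)

lemma vimage_complex_of_vec: "complex_of_vec -` S = vec_of_complex ` S"
  by (force simp: image_iff intro: complex_of_vec_inverse[symmetric])

text \<open>
  Lebesgue measure is determined by its values on boxes, and the identification maps boxes to
  boxes with the same side lengths.
\<close>

lemma lborel_complex_eq_distr: "(lborel :: complex measure) = distr lborel borel complex_of_vec"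
proof (rule lborel_eqI)
  fix l u :: complex
  assume le: "\<And>b. b \<in> Basis \<Longrightarrow> l \<bullet> b \<le> u \<bullet> b"
  have [simp]: "Re l \<le> Re u" "Im l \<le> Im u"
    using le[of 1] le[of \<i>] by (auto simp: Basis_complex_def inner_complex_def)
  have comp: "vec_of_complex l $ i \<le> vec_of_complex u $ i" for i
    using exhaust_2[of i] by (auto simp: vec_of_complex_def)
  have box: "complex_of_vec -` box l u = box (vec_of_complex l) (vec_of_complex u)"
    by (auto simp: box_def Basis_complex_def complex_of_vec_def vec_of_complex_def
        inner_complex_def Basis_vec_def inner_axis exhaust_2 forall_2)
  have "emeasure (distr lborel borel complex_of_vec) (box l u) =
        emeasure lborel (box (vec_of_complex l) (vec_of_complex u))"
    by (subst emeasure_distr) (auto simp: box[symmetric])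
  also have "\<dots> = ennreal (\<Prod>b\<in>Basis. (vec_of_complex u - vec_of_complex l) \<bullet> b)"
    by (subst emeasure_lborel_box)
       (auto simp: Basis_vec_def inner_axis comp)
  also have "(\<Prod>b\<in>Basis. (vec_of_complex u - vec_of_complex l) \<bullet> b) = (\<Prod>b\<in>Basis. (u - l) \<bullet> b)"
  proof -
    have B: "(Basis :: (real^2) set) = {axis 1 1, axis 2 1}"
      by (auto simp: Basis_vec_def UNIV_2)
    have "axis (1::2) (1::real) \<noteq> axis 2 1" by (simp add: axis_eq_axis)
    then show ?thesis
      unfolding B by (simp add: Basis_complex_def inner_axis vec_of_complex_def inner_complex_def)
  qed
  finally show "emeasure (distr lborel borel complex_of_vec) (box l u) = ennreal (\<Prod>b\<in>Basis. (u - l) \<bullet> b)" .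
qed auto

text \<open>
  Borel measurability of the integrand makes it immaterial that the left-hand sides use Borel
  measure and the right-hand sides its completion.
\<close>

lemma set_integrable_complex_iff_vec:
  fixes h :: "complex \<Rightarrow> real"
  assumes [measurable]: "(\<lambda>z. indicator S z *\<^sub>R h z) \<in> borel_measurable borel"
  shows "set_integrable lborel S h \<longleftrightarrow>
           (\<lambda>v. h (complex_of_vec v)) absolutely_integrable_on (complex_of_vec -` S)"
    and "set_lebesgue_integral lborel S h =
           set_lebesgue_integral lebesgue (complex_of_vec -` S) (\<lambda>v. h (complex_of_vec v))"
proof -
  have ind: "indicator (complex_of_vec -` S) v *\<^sub>R h (complex_of_vec v) =
      indicator S (complex_of_vec v) *\<^sub>R h (complex_of_vec v)" for v
    by (simp add: indicator_def)
  have [measurable]: "(\<lambda>z. indicat_real S z *\<^sub>R h z) \<in> borel_measurable borel"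
      "(\<lambda>v. indicat_real S (complex_of_vec v) *\<^sub>R h (complex_of_vec v)) \<in> borel_measurable lborel"
    using assms measurable_compose[OF measurable_complex_of_vec assms] by simp_all
  show "set_integrable lborel S h \<longleftrightarrow>
      (\<lambda>v. h (complex_of_vec v)) absolutely_integrable_on (complex_of_vec -` S)"
    unfolding set_integrable_def ind lborel_complex_eq_distr
    by (subst integrable_distr_eq) (simp_all add: integrable_completion del: real_scaleR_def)
  show "set_lebesgue_integral lborel S h =
           set_lebesgue_integral lebesgue (complex_of_vec -` S) (\<lambda>v. h (complex_of_vec v))"
    unfolding set_lebesgue_integral_def ind lborel_complex_eq_distr
    by (subst integral_distr) (simp_all add: integral_completion del: real_scaleR_def)
qed

text \<open>
  Multiplication by \<open>D\<close> is a rotation followed by a scaling by \<open>cmod D\<close>, so it multiplies areas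
  by \<open>(cmod D)\<^sup>2\<close>.
\<close>

lemma det_complex_mult:
  "det (matrix (\<lambda>v. vec_of_complex (D * complex_of_vec v))) = (cmod D)\<^sup>2"
  by (simp add: det_2 matrix_def axis_def complex_of_vec_def vec_of_complex_def cmod_power2 flip: power2_eq_square)

text \<open>
  The derivative of an analytic map, as a real linear map of the plane, is multiplication by a
  complex number, so by \<open>det_complex_mult\<close> its Jacobian determinant is
  \<open>(cmod (deriv \<phi> z))\<^sup>2\<close>.
\<close>

theorem conformal_change_of_variables:
  fixes h :: "complex \<Rightarrow> real"
  assumes "open S" and hol: "\<phi> holomorphic_on S" and inj: "inj_on \<phi> S"
    and h: "continuous_on (\<phi> ` S) h"
  shows "set_integrable lborel (\<phi> ` S) h \<longleftrightarrow>
           set_integrable lborel S (\<lambda>z. (cmod (deriv \<phi> z))\<^sup>2 * h (\<phi> z))"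
    and "set_lebesgue_integral lborel (\<phi> ` S) h =
           set_lebesgue_integral lborel S (\<lambda>z. (cmod (deriv \<phi> z))\<^sup>2 * h (\<phi> z))"
proof -
  define J where "J = (\<lambda>z. (cmod (deriv \<phi> z))\<^sup>2 * h (\<phi> z))"
  define T where "T = complex_of_vec -` S"
  define g where "g = (\<lambda>v. vec_of_complex (\<phi> (complex_of_vec v)))"
  define g' where "g' = (\<lambda>v w. vec_of_complex (deriv \<phi> (complex_of_vec v) * complex_of_vec w))"
  have openim: "open (\<phi> ` S)"
    using open_mapping_thm3[OF hol \<open>open S\<close> inj] .
  have contJ: "continuous_on S J"
    unfolding J_def using hol \<open>open S\<close>
    by (intro continuous_intros continuous_on_compose2[OF h] holomorphic_on_imp_continuous_on
        holomorphic_deriv) auto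
  have meas_h [measurable]: "(\<lambda>z. indicator (\<phi> ` S) z *\<^sub>R h z) \<in> borel_measurable borel"
    using openim h by (intro borel_measurable_continuous_on_indicator) auto
  have meas_J [measurable]: "(\<lambda>z. indicator S z *\<^sub>R J z) \<in> borel_measurable borel"
    using \<open>open S\<close> contJ by (intro borel_measurable_continuous_on_indicator) auto
  have "open T"
    unfolding T_def using \<open>open S\<close> bounded_linear_complex_of_vec
    by (intro continuous_open_vimage) (auto intro: linear_continuous_at)
  have T: "T \<in> sets lebesgue"
    using \<open>open T\<close> by (simp add: borel_open)
  have der: "(g has_derivative g' v) (at v within T)" if "v \<in> T" for v
  proof -
    have "(\<phi> has_field_derivative deriv \<phi> (complex_of_vec v)) (at (complex_of_vec v))"
      using that hol \<open>open S\<close> by (auto simp: T_def intro: holomorphic_derivI)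
    then have 1: "(\<phi> has_derivative (*) (deriv \<phi> (complex_of_vec v))) (at (complex_of_vec v))"
      by (simp add: has_field_derivative_def)
    have 2: "(complex_of_vec has_derivative complex_of_vec) (at v within T)"
      by (rule bounded_linear_imp_has_derivative[OF bounded_linear_complex_of_vec])
    have 3: "((\<lambda>v. \<phi> (complex_of_vec v)) has_derivative
        (\<lambda>w. deriv \<phi> (complex_of_vec v) * complex_of_vec w)) (at v within T)"
      using has_derivative_compose[OF 2 1] by simp
    show ?thesis
      unfolding g_def g'_def
      by (rule bounded_linear.has_derivative[OF bounded_linear_vec_of_complex 3])
  qed
  have injg: "inj_on g T"
    using inj unfolding inj_on_def g_def T_def
    by (metis complex_of_vec_inverse vec_of_complex_inverse vimage_eq)
  have im: "g ` T = complex_of_vec -` (\<phi> ` S)"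
  proof -
    have "T = vec_of_complex ` S" unfolding T_def by (rule vimage_complex_of_vec)
    then show ?thesis unfolding vimage_complex_of_vec by (simp add: image_image g_def)
  qed
  have det: "\<bar>det (matrix (g' v))\<bar> = (cmod (deriv \<phi> (complex_of_vec v)))\<^sup>2" for v
    unfolding g'_def det_complex_mult by simp
  \<comment> \<open>The substitution rule is for vector-valued integrands, so \<open>h\<close> becomes a one-component vector.\<close>
  define F where "F = (\<lambda>v. (\<chi> i. h (complex_of_vec v)) :: real^1)"
  have cv: "(\<lambda>v. J (complex_of_vec v)) absolutely_integrable_on T \<and>
      integral T (\<lambda>v. J (complex_of_vec v)) = b \<longleftrightarrow>
      (\<lambda>v. h (complex_of_vec v)) absolutely_integrable_on (g ` T) \<and>
      integral (g ` T) (\<lambda>v. h (complex_of_vec v)) = b" for b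
    using has_absolute_integral_change_of_variables[OF T der injg, of F "\<chi> i. b"]
    unfolding absolutely_integrable_on_1_iff integral_on_1_eq det F_def
    by (simp add: J_def g_def vec_eq_iff)
  have iff: "set_integrable lborel (\<phi> ` S) h \<longleftrightarrow> set_integrable lborel S J"
    unfolding set_integrable_complex_iff_vec(1)[OF meas_h] set_integrable_complex_iff_vec(1)[OF meas_J]
      im[symmetric] T_def[symmetric]
    using cv by blast
  show "set_integrable lborel (\<phi> ` S) h \<longleftrightarrow>
           set_integrable lborel S (\<lambda>z. (cmod (deriv \<phi> z))\<^sup>2 * h (\<phi> z))"
    using iff unfolding J_def .
  have eq: "set_lebesgue_integral lborel (\<phi> ` S) h = set_lebesgue_integral lborel S J"
    if "set_integrable lborel (\<phi> ` S) h"
  proof -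
    have "(\<lambda>v. h (complex_of_vec v)) absolutely_integrable_on (g ` T)"
      using that set_integrable_complex_iff_vec(1)[OF meas_h] by (simp add: im)
    moreover have "(\<lambda>v. J (complex_of_vec v)) absolutely_integrable_on T"
      using that iff set_integrable_complex_iff_vec(1)[OF meas_J] by (simp add: T_def)
    ultimately show ?thesis
      unfolding set_integrable_complex_iff_vec(2)[OF meas_h] set_integrable_complex_iff_vec(2)[OF meas_J]
        im[symmetric] T_def[symmetric]
      using cv by (metis set_lebesgue_integral_eq_integral(2))
  qed
  show "set_lebesgue_integral lborel (\<phi> ` S) h =
           set_lebesgue_integral lborel S (\<lambda>z. (cmod (deriv \<phi> z))\<^sup>2 * h (\<phi> z))"
    unfolding J_def[symmetric]
    \<comment> \<open>If one side is not integrable, neither is the other, and both integrals are 0.\<close>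
    using eq iff unfolding set_integrable_def set_lebesgue_integral_def
    by (metis not_integrable_integral_eq)
qed

text \<open>
  The factor \<open>(cmod (deriv \<phi> w))\<^sup>2\<close> that the chain rule puts in front of
  \<open>(cmod (deriv f (\<phi> w)))\<^sup>2\<close> is exactly the Jacobian of the substitution.
\<close>

corollary dirichlet_integral_conformal_invariance:
  assumes "open S" and \<phi>: "\<phi> holomorphic_on S" and inj: "inj_on \<phi> S"
    and f: "f holomorphic_on \<phi> ` S"
  shows "set_integrable lborel (\<phi> ` S) (\<lambda>z. (cmod (deriv f z))\<^sup>2) \<longleftrightarrow>
           set_integrable lborel S (\<lambda>w. (cmod (deriv (\<lambda>w. f (\<phi> w)) w))\<^sup>2)"
    and "set_lebesgue_integral lborel (\<phi> ` S) (\<lambda>z. (cmod (deriv f z))\<^sup>2) =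
           set_lebesgue_integral lborel S (\<lambda>w. (cmod (deriv (\<lambda>w. f (\<phi> w)) w))\<^sup>2)"
proof -
  have openim: "open (\<phi> ` S)"
    using open_mapping_thm3[OF \<phi> \<open>open S\<close> inj] .
  have cont: "continuous_on (\<phi> ` S) (\<lambda>z. (cmod (deriv f z))\<^sup>2)"
    using f openim by (intro continuous_intros holomorphic_on_imp_continuous_on holomorphic_deriv)
  have chain: "(cmod (deriv (\<lambda>w. f (\<phi> w)) w))\<^sup>2 = (cmod (deriv \<phi> w))\<^sup>2 * (cmod (deriv f (\<phi> w)))\<^sup>2"
    if "w \<in> S" for w
  proof -
    have "(\<phi> has_field_derivative deriv \<phi> w) (at w)"
      using that \<phi> \<open>open S\<close> by (auto intro: holomorphic_derivI)
    moreover have "(f has_field_derivative deriv f (\<phi> w)) (at (\<phi> w))"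
      using that f openim by (auto intro: holomorphic_derivI)
    ultimately have "((\<lambda>w. f (\<phi> w)) has_field_derivative deriv f (\<phi> w) * deriv \<phi> w) (at w)"
      by (rule DERIV_chain2[rotated])
    then show ?thesis
      by (simp add: DERIV_imp_deriv norm_mult power_mult_distrib)
  qed
  have ind: "indicat_real S w *\<^sub>R ((cmod (deriv \<phi> w))\<^sup>2 * (cmod (deriv f (\<phi> w)))\<^sup>2) =
      indicat_real S w *\<^sub>R (cmod (deriv (\<lambda>w. f (\<phi> w)) w))\<^sup>2" for w
    by (cases "w \<in> S") (simp_all add: chain)
  note cv = conformal_change_of_variables[OF \<open>open S\<close> \<phi> inj cont]
  show "set_integrable lborel (\<phi> ` S) (\<lambda>z. (cmod (deriv f z))\<^sup>2) \<longleftrightarrow>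
           set_integrable lborel S (\<lambda>w. (cmod (deriv (\<lambda>w. f (\<phi> w)) w))\<^sup>2)"
    using cv(1) unfolding set_integrable_def ind .
  show "set_lebesgue_integral lborel (\<phi> ` S) (\<lambda>z. (cmod (deriv f z))\<^sup>2) =
           set_lebesgue_integral lborel S (\<lambda>w. (cmod (deriv (\<lambda>w. f (\<phi> w)) w))\<^sup>2)"
    using cv(2) unfolding set_lebesgue_integral_def ind .
qed

section \<open>Mean-square convergence from pointwise convergence\<close>

text \<open>
  The square-integrable form of the Riesz--Scheffe principle: pointwise convergence is
  convergence in mean square as soon as the norms do not exceed the norm of the limit.  By the
  parallelogram law, \<open>2 * (norm (g n x))\<^sup>2 + 2 * (norm (f x))\<^sup>2 - (norm (g n x - f x))\<^sup>2\<close> is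
  nonnegative, and it tends to \<open>4 * (norm (f x))\<^sup>2\<close>.  Fatou's lemma then bounds
  \<open>4 * E\<close>, with \<open>E\<close> the squared norm of the limit, by \<open>4 * E\<close> minus the upper limit of the
  squared distances, which therefore tend to 0.
\<close>

lemma L2_convergence_of_norm_bound:
  fixes f :: "'a \<Rightarrow> 'b::{real_inner,second_countable_topology}"
  assumes [measurable]: "f \<in> borel_measurable M" "\<And>n. g n \<in> borel_measurable M"
    and f: "integrable M (\<lambda>x. (norm (f x))\<^sup>2)"
    and g: "\<And>n. integrable M (\<lambda>x. (norm (g n x))\<^sup>2)"
    and lim: "\<And>x. (\<lambda>n. g n x) \<longlonglongrightarrow> f x"
    and bound: "\<And>n. (\<integral>x. (norm (g n x))\<^sup>2 \<partial>M) \<le> (\<integral>x. (norm (f x))\<^sup>2 \<partial>M)"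
  shows "\<And>n. integrable M (\<lambda>x. (norm (g n x - f x))\<^sup>2)"
    and "(\<lambda>n. \<integral>x. (norm (g n x - f x))\<^sup>2 \<partial>M) \<longlonglongrightarrow> 0"
proof -
  define E where "E = (\<integral>x. (norm (f x))\<^sup>2 \<partial>M)"
  define I where "I = (\<lambda>n. \<integral>x. (norm (g n x - f x))\<^sup>2 \<partial>M)"
  define u where "u = (\<lambda>n x. 2 * (norm (g n x))\<^sup>2 + 2 * (norm (f x))\<^sup>2 - (norm (g n x - f x))\<^sup>2)"
  have u_eq: "u n x = (norm (g n x + f x))\<^sup>2" for n x
    unfolding u_def by (simp add: power2_norm_eq_inner inner_simps inner_commute)
  have dom: "(norm (g n x - f x))\<^sup>2 \<le> 2 * (norm (g n x))\<^sup>2 + 2 * (norm (f x))\<^sup>2" for n x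
    using u_eq[of n x] unfolding u_def by (smt (verit) zero_le_power2)
  show int: "integrable M (\<lambda>x. (norm (g n x - f x))\<^sup>2)" for n
  proof (rule Bochner_Integration.integrable_bound)
    show "integrable M (\<lambda>x. 2 * (norm (g n x))\<^sup>2 + 2 * (norm (f x))\<^sup>2)"
      using f g[of n] by simp
    show "AE x in M. norm ((norm (g n x - f x))\<^sup>2) \<le> norm (2 * (norm (g n x))\<^sup>2 + 2 * (norm (f x))\<^sup>2)"
      using order_trans[OF dom abs_ge_self] by (intro AE_I2) simp
  qed measurable
  have int_u: "integrable M (u n)" for n
    unfolding u_def using f g[of n] int[of n] by (intro Bochner_Integration.integrable_diff Bochner_Integration.integrable_add integrable_mult_right)
  have u_le: "(\<integral>x. u n x \<partial>M) \<le> 4 * E - I n" for n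
    unfolding u_def using f g[of n] int[of n] bound[of n] by (simp add: E_def I_def)
  have u_lim: "(\<lambda>n. ennreal (u n x)) \<longlonglongrightarrow> ennreal (4 * (norm (f x))\<^sup>2)" for x
  proof -
    have "(\<lambda>n. u n x) \<longlonglongrightarrow> (norm (f x + f x))\<^sup>2"
      unfolding u_eq by (intro tendsto_intros lim)
    moreover have "norm (f x + f x) = 2 * norm (f x)"
      by (metis norm_scaleR abs_numeral scaleR_2)
    ultimately show ?thesis by (intro tendsto_ennrealI) (simp add: power_mult_distrib)
  qed
  have "ennreal (4 * E) = (\<integral>\<^sup>+x. ennreal (4 * (norm (f x))\<^sup>2) \<partial>M)"
    unfolding E_def using f by (subst nn_integral_eq_integral) auto
  also have "\<dots> = (\<integral>\<^sup>+x. liminf (\<lambda>n. ennreal (u n x)) \<partial>M)"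
    using u_lim by (intro nn_integral_cong) (simp add: lim_imp_Liminf[OF trivial_limit_sequentially u_lim])
  also have "\<dots> \<le> liminf (\<lambda>n. \<integral>\<^sup>+x. ennreal (u n x) \<partial>M)"
    using int_u by (intro nn_integral_liminf) auto
  also have "\<dots> = liminf (\<lambda>n. ennreal (\<integral>x. u n x \<partial>M))"
    using int_u by (subst nn_integral_eq_integral) (auto simp: u_eq)
  finally have fatou: "ennreal (4 * E) \<le> liminf (\<lambda>n. ennreal (\<integral>x. u n x \<partial>M))" .
  have "\<forall>\<^sub>F n in sequentially. I n < e" if "e > 0" for e
  proof (cases "4 * E - e < 0")
    case True
    have "0 \<le> (\<integral>x. u n x \<partial>M)" for n by (simp add: u_eq)
    then have "I n < e" for n using u_le[of n] True by (smt (verit))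
    then show ?thesis by simp
  next
    case False
    then have "ennreal (4 * E - e) < ennreal (4 * E)"
      using \<open>e > 0\<close> by (simp add: ennreal_less_iff)
    with fatou have "ennreal (4 * E - e) < liminf (\<lambda>n. ennreal (\<integral>x. u n x \<partial>M))"
      by simp
    then have "\<forall>\<^sub>F n in sequentially. ennreal (4 * E - e) < ennreal (\<integral>x. u n x \<partial>M)"
      by (rule less_LiminfD)
    then show ?thesis
    proof eventually_elim
      case (elim n)
      then have "4 * E - e < (\<integral>x. u n x \<partial>M)"
        using False by (simp add: ennreal_less_iff)
      then show ?case using u_le[of n] by linarith
    qed
  qed
  moreover have "0 \<le> I n" for n unfolding I_def by simp
  ultimately show "(\<lambda>n. \<integral>x. (norm (g n x - f x))\<^sup>2 \<partial>M) \<longlonglongrightarrow> 0"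
    unfolding I_def[symmetric] by (intro tendstoI) (simp add: dist_real_def)
qed

section \<open>Polynomial approximation in the disc\<close>

text \<open>
  A Taylor series converges uniformly on every closed disc strictly inside its disc of
  convergence, so its partial sums are the required polynomials.
\<close>

lemma uniform_polynomial_approx:
  assumes hol: "g holomorphic_on ball 0 R" and r: "0 < r" "r < R" and "\<epsilon> > 0"
  obtains p :: "complex poly" where "\<And>z. z \<in> cball 0 r \<Longrightarrow> cmod (g z - poly p z) < \<epsilon>"
proof -
  define a where "a = (\<lambda>n. (deriv ^^ n) g 0 / fact n)"
  have sums: "(\<lambda>n. a n * z ^ n) sums g z" if "z \<in> ball 0 R" for z
    using holomorphic_power_series[OF hol that] by (simp add: a_def)
  \<comment> \<open>Convergence at a point strictly between the two radii puts \<open>r\<close> strictly below the radius of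
    convergence.\<close>
  define s where "s = (r + R) / 2"
  have s: "0 < s" "r < s" "s < R" using r by (simp_all add: s_def)
  then have "of_real s \<in> ball (0::complex) R" by simp
  then have "summable (\<lambda>n. a n * of_real s ^ n)"
    using sums sums_summable by blast
  then have "norm (of_real s :: complex) \<le> conv_radius a"
    by (rule conv_radius_geI)
  then have "ereal s \<le> conv_radius a" using s by simp
  moreover have "ereal r < ereal s" using s by simp
  ultimately have "ereal r < conv_radius a" by (rule less_le_trans[rotated])
  then have "uniform_limit (cball 0 r) (\<lambda>n z. \<Sum>i<n. a i * (z - 0) ^ i)
      (\<lambda>z. \<Sum>i. a i * (z - 0) ^ i) sequentially"
    by (rule powser_uniform_limit)
  then have "\<forall>\<^sub>F n in sequentially. \<forall>z\<in>cball 0 r. dist (\<Sum>i<n. a i * (z - 0) ^ i) (\<Sum>i. a i * (z - 0) ^ i) < \<epsilon>"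
    using \<open>\<epsilon> > 0\<close> unfolding uniform_limit_iff by blast
  then obtain n where n: "\<forall>z\<in>cball 0 r. dist (\<Sum>i<n. a i * z ^ i) (\<Sum>i. a i * z ^ i) < \<epsilon>"
    unfolding diff_0_right eventually_sequentially by blast
  have "(\<Sum>i. a i * z ^ i) = g z" if "z \<in> cball 0 r" for z
    using sums[of z] that r by (auto simp: sums_iff)
  with n have "cmod (g z - poly (\<Sum>i<n. monom (a i) i) z) < \<epsilon>" if "z \<in> cball 0 r" for z
    using that by (simp add: poly_sum poly_monom dist_norm norm_minus_commute)
  with that show ?thesis by blast
qed

text \<open>
  After the substitution \<open>w = r * z\<close> the integral of the dilated function is the integral of the
  original one over the smaller disc of radius \<open>r\<close>.  The factor \<open>r\<close> in front of \<open>g\<close> absorbs the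
  Jacobian, so that dilation does not increase the norm.
\<close>

lemma dilation_square_integral:
  assumes hol: "g holomorphic_on ball 0 1" and int: "set_integrable lborel (ball 0 1) (\<lambda>z. (cmod (g z))\<^sup>2)"
    and r: "0 < r" "r < 1"
  shows "set_integrable lborel (ball 0 1) (\<lambda>z. (cmod (of_real r * g (of_real r * z)))\<^sup>2)"
    and "set_lebesgue_integral lborel (ball 0 1) (\<lambda>z. (cmod (of_real r * g (of_real r * z)))\<^sup>2)
           \<le> set_lebesgue_integral lborel (ball 0 1) (\<lambda>z. (cmod (g z))\<^sup>2)"
proof -
  define \<phi> where "\<phi> = (\<lambda>z::complex. of_real r * z)"
  have "(\<lambda>x. r *\<^sub>R x) ` ball 0 1 = ball (0::complex) r"
    using ball_scale[of r "0::complex" 1] r by simp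
  then have im: "\<phi> ` ball 0 1 = ball 0 r"
    by (simp add: \<phi>_def scaleR_conv_of_real)
  have sub: "ball 0 r \<subseteq> ball (0::complex) 1" using r by auto
  have der: "deriv \<phi> z = of_real r" for z
    unfolding \<phi>_def by (intro DERIV_imp_deriv) (auto intro!: derivative_eq_intros)
  have "\<phi> holomorphic_on ball 0 1" "inj_on \<phi> (ball 0 1)"
    using r by (auto simp: \<phi>_def inj_on_def intro!: holomorphic_intros)
  moreover have "continuous_on (\<phi> ` ball 0 1) (\<lambda>z. (cmod (g z))\<^sup>2)"
    unfolding im using hol sub
    by (intro continuous_intros) (auto intro: continuous_on_subset holomorphic_on_imp_continuous_on)
  ultimately have cv: "set_integrable lborel (ball 0 r) (\<lambda>z. (cmod (g z))\<^sup>2) \<longleftrightarrow>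
      set_integrable lborel (ball 0 1) (\<lambda>z. (cmod (of_real r * g (of_real r * z)))\<^sup>2)"
    "set_lebesgue_integral lborel (ball 0 r) (\<lambda>z. (cmod (g z))\<^sup>2) =
      set_lebesgue_integral lborel (ball 0 1) (\<lambda>z. (cmod (of_real r * g (of_real r * z)))\<^sup>2)"
    using conformal_change_of_variables[of "ball 0 1" \<phi> "\<lambda>z. (cmod (g z))\<^sup>2"]
    unfolding im der by (simp_all add: \<phi>_def norm_mult power_mult_distrib)
  have int_r: "set_integrable lborel (ball 0 r) (\<lambda>z. (cmod (g z))\<^sup>2)"
    using set_integrable_subset[OF int _ sub] by simp
  then show "set_integrable lborel (ball 0 1) (\<lambda>z. (cmod (of_real r * g (of_real r * z)))\<^sup>2)"
    using cv by simp
  have "set_lebesgue_integral lborel (ball 0 r) (\<lambda>z. (cmod (g z))\<^sup>2) \<le>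
      set_lebesgue_integral lborel (ball 0 1) (\<lambda>z. (cmod (g z))\<^sup>2)"
    using int_r int sub unfolding set_lebesgue_integral_def set_integrable_def
    by (intro integral_mono) (auto simp: indicator_def)
  then show "set_lebesgue_integral lborel (ball 0 1) (\<lambda>z. (cmod (of_real r * g (of_real r * z)))\<^sup>2)
           \<le> set_lebesgue_integral lborel (ball 0 1) (\<lambda>z. (cmod (g z))\<^sup>2)"
    using cv by simp
qed

text \<open>
  Density of the polynomials in the Bergman space of the disc.  A function \<open>g\<close> in it need not
  extend past the unit circle, but its dilates \<open>r * g (r * z)\<close> do, so their Taylor polynomials
  approximate them uniformly on the disc, and hence in mean square because the disc has finite
  area.  As \<open>r\<close> tends to 1 the dilates converge to \<open>g\<close> pointwise without exceeding its norm,
  hence also in mean square.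
\<close>

lemma polynomials_dense_bergman_disc:
  assumes hol: "g holomorphic_on ball 0 1"
    and int: "set_integrable lborel (ball 0 1) (\<lambda>z. (cmod (g z))\<^sup>2)"
    and "\<epsilon> > 0"
  obtains p where "set_lebesgue_integral lborel (ball 0 1) (\<lambda>z. (cmod (g z - poly p z))\<^sup>2) < \<epsilon>"
proof -
  define B where "B = ball (0::complex) 1"
  define r where "r = (\<lambda>n. real (Suc n) / real (n + 2))"
  have r: "0 < r n" "r n < 1" for n by (auto simp: r_def field_simps)
  have r_lim: "r \<longlonglongrightarrow> 1"
    unfolding r_def by real_asymp
  define G where "G = (\<lambda>n z. of_real (r n) * g (of_real (r n) * z))"
  have scale: "of_real (r n) * z \<in> B" if "z \<in> B" for n z
    using that r[of n] by (simp add: B_def norm_mult) (smt (verit) mult_left_le_one_le norm_ge_zero)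
  have cont_g: "continuous_on B g"
    using hol unfolding B_def by (rule holomorphic_on_imp_continuous_on)
  have cont_G: "continuous_on B (G n)" for n
    unfolding G_def
    by (intro continuous_intros continuous_on_compose2[OF cont_g]) (auto simp: scale)
  define f0 where "f0 = (\<lambda>z. indicat_real B z *\<^sub>R g z)"
  define g0 where "g0 = (\<lambda>n z. indicat_real B z *\<^sub>R G n z)"
  have ind: "(cmod (indicat_real B z *\<^sub>R c))\<^sup>2 = indicat_real B z *\<^sub>R (cmod c)\<^sup>2" for z c
    by (simp add: indicator_def)
  have lim: "(\<lambda>n. g0 n z) \<longlonglongrightarrow> f0 z" for z
  proof (cases "z \<in> B")
    case True
    have "isCont g z"
      using True cont_g by (simp add: B_def continuous_on_eq_continuous_at)
    moreover have "(\<lambda>n. of_real (r n) * z) \<longlonglongrightarrow> of_real 1 * z"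
      by (intro tendsto_intros r_lim)
    ultimately have "(\<lambda>n. g (of_real (r n) * z)) \<longlonglongrightarrow> g z"
      by (intro isCont_tendsto_compose[of z g]) simp_all
    then have "(\<lambda>n. G n z) \<longlonglongrightarrow> of_real 1 * g z"
      unfolding G_def by (intro tendsto_intros r_lim)
    then show ?thesis using True by (simp add: g0_def f0_def)
  qed (simp add: g0_def f0_def)
  have conv: "integrable lborel (\<lambda>z. (cmod (g0 n z - f0 z))\<^sup>2)"
    "(\<lambda>n. \<integral>z. (cmod (g0 n z - f0 z))\<^sup>2 \<partial>lborel) \<longlonglongrightarrow> 0" for n
  proof -
    have *: "f0 \<in> borel_measurable lborel" "\<And>n. g0 n \<in> borel_measurable lborel"
      unfolding f0_def g0_def using cont_g cont_G
      by (auto intro!: borel_measurable_continuous_on_indicator simp: B_def)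
    have "integrable lborel (\<lambda>z. (cmod (f0 z))\<^sup>2)"
      using int unfolding f0_def ind by (simp add: set_integrable_def B_def)
    moreover have "integrable lborel (\<lambda>z. (cmod (g0 n z))\<^sup>2)" for n
      using dilation_square_integral(1)[OF hol int r] unfolding g0_def G_def ind
      by (simp add: set_integrable_def B_def)
    moreover have "(\<integral>z. (cmod (g0 n z))\<^sup>2 \<partial>lborel) \<le> (\<integral>z. (cmod (f0 z))\<^sup>2 \<partial>lborel)" for n
      using dilation_square_integral(2)[OF hol int r] unfolding f0_def g0_def G_def ind
      by (simp add: set_lebesgue_integral_def B_def)
    ultimately show "integrable lborel (\<lambda>z. (cmod (g0 n z - f0 z))\<^sup>2)"
        "(\<lambda>n. \<integral>z. (cmod (g0 n z - f0 z))\<^sup>2 \<partial>lborel) \<longlonglongrightarrow> 0"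
      using L2_convergence_of_norm_bound[OF * _ _ lim] by blast+
  qed
  obtain n where n: "(\<integral>z. (cmod (g0 n z - f0 z))\<^sup>2 \<partial>lborel) < \<epsilon> / 4"
    using order_tendstoD(2)[OF conv(2), of "\<epsilon> / 4"] \<open>\<epsilon> > 0\<close> eventually_happens by force
  define \<mu> where "\<mu> = measure lborel B"
  have "\<mu> \<ge> 0" by (simp add: \<mu>_def)
  \<comment> \<open>A uniform error \<open>\<delta>\<close> contributes at most \<open>2 * \<delta>\<^sup>2 * \<mu> \<le> \<epsilon> / 2\<close> to the squared distance; the
    summand 1 keeps the divisor positive.\<close>
  define \<delta> where "\<delta> = sqrt (\<epsilon> / (4 * (\<mu> + 1)))"
  have \<delta>: "\<delta> > 0" using \<open>\<epsilon> > 0\<close> \<open>\<mu> \<ge> 0\<close> by (simp add: \<delta>_def)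
  have \<delta>2: "2 * (\<delta>\<^sup>2 * \<mu>) \<le> \<epsilon> / 2"
    using \<open>\<epsilon> > 0\<close> \<open>\<mu> \<ge> 0\<close> by (simp add: \<delta>_def field_simps)
  have "G n holomorphic_on ball 0 (1 / r n)"
  proof -
    have "(\<lambda>z. of_real (r n) * z) ` ball 0 (1 / r n) \<subseteq> ball (0::complex) 1"
      using r[of n] by (auto simp: norm_mult field_simps)
    then show ?thesis
      unfolding G_def
      by (intro holomorphic_intros holomorphic_on_compose_gen[OF _ hol, unfolded o_def]) auto
  qed
  moreover have "1 < 1 / r n" using r[of n] by (simp add: field_simps)
  ultimately obtain p where p: "\<And>z. z \<in> cball 0 1 \<Longrightarrow> cmod (G n z - poly p z) < \<delta>"
    using uniform_polynomial_approx[of "G n" "1 / r n" 1 \<delta>] \<delta> by auto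
  have pointwise: "indicat_real B z *\<^sub>R (cmod (g z - poly p z))\<^sup>2 \<le>
      2 * (cmod (g0 n z - f0 z))\<^sup>2 + 2 * \<delta>\<^sup>2 * indicat_real B z" for z
  proof (cases "z \<in> B")
    case True
    have "cmod (g z - poly p z) \<le> cmod (G n z - g z) + cmod (G n z - poly p z)"
      using norm_triangle_ineq4[of "G n z - poly p z" "G n z - g z"] by simp
    also have "\<dots> \<le> cmod (G n z - g z) + \<delta>"
      using p[of z] True by (simp add: B_def)
    finally have "(cmod (g z - poly p z))\<^sup>2 \<le> (cmod (G n z - g z) + \<delta>)\<^sup>2"
      by (intro power_mono) auto
    also have "\<dots> \<le> 2 * (cmod (G n z - g z))\<^sup>2 + 2 * \<delta>\<^sup>2"
      using zero_le_power2[of "cmod (G n z - g z) - \<delta>"] by (simp add: power2_sum power2_diff)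
    finally show ?thesis using True by (simp add: g0_def f0_def)
  qed simp
  have finB: "integrable lborel (indicat_real B)"
    unfolding B_def using emeasure_bounded_finite[OF bounded_ball, of "0::complex" 1]
    by (intro integrable_real_indicator) simp_all
  have "(\<integral>z. indicat_real B z *\<^sub>R (cmod (g z - poly p z))\<^sup>2 \<partial>lborel) \<le>
      (\<integral>z. 2 * (cmod (g0 n z - f0 z))\<^sup>2 + 2 * \<delta>\<^sup>2 * indicat_real B z \<partial>lborel)"
    using conv(1) finB pointwise by (intro integral_mono') auto
  also have "\<dots> = 2 * (\<integral>z. (cmod (g0 n z - f0 z))\<^sup>2 \<partial>lborel) + 2 * \<delta>\<^sup>2 * \<mu>"
    using conv(1) finB by (simp add: \<mu>_def)
  also have "\<dots> < \<epsilon>" using n \<delta>2 by simp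
  finally show ?thesis
    using that unfolding set_lebesgue_integral_def B_def by blast
qed

section \<open>The Cayley transform\<close>

definition cayley :: "complex \<Rightarrow> complex" where
  "cayley z = (z - \<i>) / (z + \<i>)"

definition inv_cayley :: "complex \<Rightarrow> complex" where
  "inv_cayley w = \<i> * (1 + w) / (1 - w)"

lemma upper_half_plane_nonzero: "z \<in> upper_half_plane \<Longrightarrow> z + \<i> \<noteq> 0"
  by (auto simp: upper_half_plane_def complex_eq_iff)

lemma cayley_in_disc:
  assumes "z \<in> upper_half_plane"
  shows "cayley z \<in> ball 0 1"
proof -
  have "(cmod (z - \<i>))\<^sup>2 < (cmod (z + \<i>))\<^sup>2"
    using assms unfolding cmod_power2 by (simp add: upper_half_plane_def power2_eq_square algebra_simps)
  then have "cmod (z - \<i>) < cmod (z + \<i>)"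
    by (rule power_less_imp_less_base) simp
  then show ?thesis
    using upper_half_plane_nonzero[OF assms] by (simp add: cayley_def norm_divide)
qed

lemma inv_cayley_in_upper_half_plane:
  assumes "w \<in> ball 0 1"
  shows "inv_cayley w \<in> upper_half_plane"
proof -
  have "w \<noteq> 1" using assms by auto
  then have pos: "(1 - Re w)\<^sup>2 + (Im w)\<^sup>2 > 0"
    by (simp add: complex_eq_iff sum_power2_gt_zero_iff)
  have "(cmod w)\<^sup>2 < 1"
    using assms by (simp add: power_less_one_iff)
  then have "(Re w)\<^sup>2 + (Im w)\<^sup>2 < 1" unfolding cmod_power2 .
  moreover have "Im (inv_cayley w) = (1 - ((Re w)\<^sup>2 + (Im w)\<^sup>2)) / ((1 - Re w)\<^sup>2 + (Im w)\<^sup>2)"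
    unfolding inv_cayley_def by (simp add: Im_divide algebra_simps power2_eq_square)
  ultimately show ?thesis
    using pos by (simp add: upper_half_plane_def)
qed

lemma cayley_inv_cayley:
  assumes "w \<in> ball 0 1"
  shows "cayley (inv_cayley w) = w"
proof -
  have "w \<noteq> 1" using assms by auto
  then show ?thesis by (simp add: cayley_def inv_cayley_def field_simps)
qed

lemma inv_cayley_cayley:
  assumes "z \<in> upper_half_plane"
  shows "inv_cayley (cayley z) = z"
proof -
  have "1 + cayley z = 2 * z / (z + \<i>)" "1 - cayley z = 2 * \<i> / (z + \<i>)"
    using upper_half_plane_nonzero[OF assms] by (simp_all add: cayley_def field_simps)
  then show ?thesis
    using upper_half_plane_nonzero[OF assms] by (simp add: inv_cayley_def)
qed

lemma inv_cayley_image: "inv_cayley ` ball 0 1 = upper_half_plane"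
  using cayley_in_disc inv_cayley_cayley inv_cayley_in_upper_half_plane
  by (metis (no_types, lifting) image_eqI image_subsetI subsetI subset_antisym)

lemma inj_on_inv_cayley: "inj_on inv_cayley (ball 0 1)"
  by (rule inj_on_inverseI[of _ cayley]) (rule cayley_inv_cayley)

lemma holomorphic_inv_cayley: "inv_cayley holomorphic_on ball 0 1"
  unfolding inv_cayley_def by (intro holomorphic_intros) auto

lemma holomorphic_cayley: "cayley holomorphic_on upper_half_plane"
  unfolding cayley_def by (intro holomorphic_intros) (rule upper_half_plane_nonzero)

lemma rational_on_cayley: "rational_on upper_half_plane cayley"
  unfolding rational_on_def
  by (intro exI[of _ "[:-\<i>, 1:]"] exI[of _ "[:\<i>, 1:]"])
     (use upper_half_plane_nonzero in \<open>auto simp: cayley_def add.commute\<close>)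

section \<open>Rational functions in the Dirichlet space\<close>

lemma poly_antiderivative:
  fixes p :: "'a::field_char_0 poly"
  obtains P where "pderiv P = p" "poly P 0 = c"
proof
  define Q where "Q = (\<Sum>i\<le>degree p. monom (coeff p i / of_nat (Suc i)) (Suc i))"
  have "pderiv Q = (\<Sum>i\<le>degree p. monom (coeff p i) i)"
    unfolding Q_def higher_pderiv_sum[of 1, simplified] pderiv_monom
    by (intro sum.cong refl) (simp del: of_nat_Suc)
  then show "pderiv (Q + [:c:]) = p"
    by (simp add: pderiv_add poly_as_sum_of_monoms pderiv_pCons)
  show "poly (Q + [:c:]) 0 = c"
    by (simp add: Q_def poly_sum poly_monom)
qed

lemma rational_on_const: "rational_on S (\<lambda>z. c)"
  unfolding rational_on_def by (intro exI[of _ "[:c:]"] exI[of _ 1]) simp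

lemma rational_on_add:
  assumes "rational_on S f" "rational_on S g"
  shows "rational_on S (\<lambda>z. f z + g z)"
proof -
  obtain p q p' q' where "\<forall>z\<in>S. poly q z \<noteq> 0 \<and> f z = poly p z / poly q z"
      "\<forall>z\<in>S. poly q' z \<noteq> 0 \<and> g z = poly p' z / poly q' z"
    using assms unfolding rational_on_def by blast
  then show ?thesis
    unfolding rational_on_def
    by (intro exI[of _ "p * q' + p' * q"] exI[of _ "q * q'"]) (auto simp: field_simps)
qed

lemma rational_on_mult:
  assumes "rational_on S f" "rational_on S g"
  shows "rational_on S (\<lambda>z. f z * g z)"
proof -
  obtain p q p' q' where "\<forall>z\<in>S. poly q z \<noteq> 0 \<and> f z = poly p z / poly q z"
      "\<forall>z\<in>S. poly q' z \<noteq> 0 \<and> g z = poly p' z / poly q' z"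
    using assms unfolding rational_on_def by blast
  then show ?thesis
    unfolding rational_on_def
    by (intro exI[of _ "p * p'"] exI[of _ "q * q'"]) auto
qed

lemma rational_on_poly_compose:
  assumes "rational_on S f"
  shows "rational_on S (\<lambda>z. poly P (f z))"
proof (induction P)
  case (pCons a P)
  then show ?case
    using rational_on_add[OF rational_on_const rational_on_mult[OF assms]] by simp
qed (simp add: rational_on_const)

theorem theorem3p1:
  shows "\<forall>f\<in>dirichlet_space. \<forall>\<epsilon>>0. \<exists>r\<in>dirichlet_rational.
           dirichlet_norm (\<lambda>z. f z - r z) < \<epsilon>"
proof (intro ballI allI impI)
  fix f :: "complex \<Rightarrow> complex" and \<epsilon> :: real
  assume "f \<in> dirichlet_space" and "\<epsilon> > 0"
  then have f: "f holomorphic_on upper_half_plane"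
    and f_int: "set_integrable lborel upper_half_plane (\<lambda>z. (cmod (deriv f z))\<^sup>2)"
    by (auto simp: dirichlet_space_def)
  note transfer = dirichlet_integral_conformal_invariance[OF open_ball holomorphic_inv_cayley
      inj_on_inv_cayley, unfolded inv_cayley_image]
  define g where "g = (\<lambda>w. f (inv_cayley w))"
  have g: "g holomorphic_on ball 0 1"
    unfolding g_def
    by (rule holomorphic_on_compose_gen[OF holomorphic_inv_cayley f, unfolded o_def])
       (simp add: inv_cayley_image)
  have "set_integrable lborel (ball 0 1) (\<lambda>w. (cmod (deriv g w))\<^sup>2)"
    using transfer(1)[OF f] f_int by (simp add: g_def)
  then obtain p where p: "set_lebesgue_integral lborel (ball 0 1)
      (\<lambda>w. (cmod (deriv g w - poly p w))\<^sup>2) < \<epsilon>\<^sup>2"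
    using polynomials_dense_bergman_disc[of "deriv g" "\<epsilon>\<^sup>2"] g \<open>\<epsilon> > 0\<close>
    by (auto simp: holomorphic_deriv)
  \<comment> \<open>The inverse Cayley transform sends 0 to \<open>\<i>\<close>, so this constant of integration makes the
    approximant agree with \<open>f\<close> at \<open>\<i>\<close> and kills the point evaluation in the norm.\<close>
  obtain P where P: "pderiv P = p" "poly P 0 = f \<i>"
    using poly_antiderivative by blast
  define r where "r = (\<lambda>z. poly P (cayley z))"
  have r: "r holomorphic_on upper_half_plane"
    unfolding r_def by (intro holomorphic_intros holomorphic_cayley)
  have der_r: "deriv (\<lambda>w. r (inv_cayley w)) w = poly p w" if "w \<in> ball 0 1" for w
  proof (rule DERIV_imp_deriv)
    have "(poly P has_field_derivative poly p w) (at w)"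
      using poly_DERIV[of P w] by (simp add: P)
    then show "((\<lambda>w. r (inv_cayley w)) has_field_derivative poly p w) (at w)"
      by (rule has_field_derivative_transform_within_open[OF _ open_ball that]) (simp add: r_def cayley_inv_cayley)
  qed
  have der_fr: "deriv (\<lambda>w. f (inv_cayley w) - r (inv_cayley w)) w = deriv g w - poly p w"
    if "w \<in> ball 0 1" for w
  proof -
    have "(\<lambda>w. r (inv_cayley w)) holomorphic_on ball 0 1"
      by (rule holomorphic_on_compose_gen[OF holomorphic_inv_cayley r, unfolded o_def])
         (simp add: inv_cayley_image)
    then show ?thesis
      using g that der_r[OF that] unfolding g_def
      by (subst deriv_diff) (auto simp: holomorphic_on_imp_differentiable_at)
  qed
  have "set_integrable lborel (ball 0 1) (\<lambda>w. (cmod (poly p w))\<^sup>2)"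
  proof (rule set_integrable_subset)
    show "set_integrable lborel (cball 0 1) (\<lambda>w. (cmod (poly p w))\<^sup>2)"
      unfolding set_integrable_def
      by (intro borel_integrable_compact compact_cball continuous_intros)
  qed auto
  then have "set_integrable lborel (ball 0 1) (\<lambda>w. (cmod (deriv (\<lambda>w. r (inv_cayley w)) w))\<^sup>2)"
    using der_r by (subst set_integrable_cong[OF refl refl]) auto
  then have "set_integrable lborel upper_half_plane (\<lambda>z. (cmod (deriv r z))\<^sup>2)"
    using transfer(1)[OF r] by simp
  then have "r \<in> dirichlet_rational"
    using r rational_on_poly_compose[OF rational_on_cayley, of P]
    by (auto simp: dirichlet_rational_def dirichlet_space_def r_def)
  moreover have "dirichlet_norm (\<lambda>z. f z - r z) < \<epsilon>"
  proof -
    have "set_lebesgue_integral lborel upper_half_plane (\<lambda>z. (cmod (deriv (\<lambda>z. f z - r z) z))\<^sup>2) =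
        set_lebesgue_integral lborel (ball 0 1) (\<lambda>w. (cmod (deriv g w - poly p w))\<^sup>2)"
      using f r by (subst transfer(2)) (auto intro!: holomorphic_intros set_lebesgue_integral_cong simp: der_fr)
    moreover have "f \<i> - r \<i> = 0"
      by (simp add: r_def cayley_def P)
    ultimately have "dirichlet_norm (\<lambda>z. f z - r z) < sqrt (\<epsilon>\<^sup>2)"
      unfolding dirichlet_norm_def using p by (subst real_sqrt_less_iff) simp
    then show ?thesis using \<open>\<epsilon> > 0\<close> by simp
  qed
  ultimately show "\<exists>r\<in>dirichlet_rational. dirichlet_norm (\<lambda>z. f z - r z) < \<epsilon>" by blast
qed

end
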